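(* Let $p$ be an $E$-distance on a separated uniform space $X$ such that $X$ is $p$-complete. Let $T:X\to X$ be a $p$-continuous $E$-asymptotic contraction, i.e. there are functions $\varphi_n:[0,\infty)\to[0,\infty)$ ($n\ge 1$) and a function $\varphi\in\Phi$ such that $\varphi_n\to\varphi$ uniformly on the range of $p$ and $$p(T^nx,T^ny)\le\varphi_n\big(p(x,y)\big)\quad\text{for all }x,y\in X\text{ and }n\ge 1,$$ and suppose that the functions $\varphi_n$ are continuous on $[0,\infty)$ for all sufficiently large $n$. Then $T$ has a unique fixed point $u\in X$, and $T^nx\stackrel{p}{\longrightarrow}u$ for all $x\in X$.
   Context: A uniform space is a nonempty set $X$ with a uniformity $\mathscr U$ (a collection of entourages, subsets of $X\times X$, in the usual sense). It is separated if the intersection of all entourages is the diagonal $\{(x,x):x\in X\}$. An $E$-distance on a uniform space $X$ is a function $p:X\times X\to[0,\infty)$ such that (i) for each entourage $U$ there exists $\delta>0$ such that, for all $x,y,z\in X$, $p(z,x)\le\delta$ and $p(z,y)\le\delta$ imply $(x,y)\in U$; and (ii) $p(x,y)\le p(x,z)+p(z,y)$ for all $x,y,z\in X$. (No symmetry is assumed, nor $p(x,x)=0$.) A sequence $\{x_n\}$ in $X$ is $p$-convergent to $x\in X$, written $x_n\stackrel{p}{\longrightarrow}x$, if $p(x_n,x)\to0$ as $n\to\infty$; it is $p$-Cauchy if $p(x_m,x_n)\to0$ as $m,n\to\infty$. $X$ is $p$-complete if every $p$-Cauchy sequence in $X$ is $p$-convergent to some point of $X$. A mapping $T:X\to X$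 is $p$-continuous if $x_n\stackrel{p}{\longrightarrow}x$ implies $Tx_n\stackrel{p}{\longrightarrow}Tx$ for all sequences $\{x_n\}$ and points $x$ in $X$. $\Phi$ is the class of all continuous functions $\varphi:[0,\infty)\to[0,\infty)$ with $\varphi(t)<t$ for all $t>0$. The range of $p$ is the set $\{p(x,y):x,y\in X\}$. $T^n$ denotes the $n$-th iterate of $T$. *)

theory Defs
  imports "HOL-Analysis.Uniform_Limit"
begin

definition entourage :: "('a::uniform_space \<times> 'a) set \<Rightarrow> bool" where
  "entourage U \<longleftrightarrow> (\<forall>\<^sub>F z in uniformity. z \<in> U)"

definition separated :: "'a::uniform_space itself \<Rightarrow> bool" where
  "separated _ \<longleftrightarrow> \<Inter> {U :: ('a \<times> 'a) set. entourage U} = Id"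

definition E_distance :: "('a::uniform_space \<Rightarrow> 'a \<Rightarrow> real) \<Rightarrow> bool" where
  "E_distance p \<longleftrightarrow>
     (\<forall>x y. 0 \<le> p x y) \<and>
     (\<forall>U. entourage U \<longrightarrow>
        (\<exists>\<delta>>0. \<forall>x y z. p z x \<le> \<delta> \<and> p z y \<le> \<delta> \<longrightarrow> (x, y) \<in> U)) \<and>
     (\<forall>x y z. p x y \<le> p x z + p z y)"

definition p_convergent :: "('a \<Rightarrow> 'a \<Rightarrow> real) \<Rightarrow> (nat \<Rightarrow> 'a) \<Rightarrow> 'a \<Rightarrow> bool" where
  "p_convergent p X x \<longleftrightarrow> (\<lambda>n. p (X n) x) \<longlonglongrightarrow> 0"

definition p_Cauchy :: "('a \<Rightarrow> 'a \<Rightarrow> real) \<Rightarrow> (nat \<Rightarrow> 'a) \<Rightarrow> bool" where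
  "p_Cauchy p X \<longleftrightarrow>
     ((\<lambda>(m, n). p (X m) (X n)) \<longlongrightarrow> 0) (sequentially \<times>\<^sub>F sequentially)"

definition p_complete :: "('a \<Rightarrow> 'a \<Rightarrow> real) \<Rightarrow> bool" where
  "p_complete p \<longleftrightarrow> (\<forall>X. p_Cauchy p X \<longrightarrow> (\<exists>x. p_convergent p X x))"

definition p_continuous :: "('a \<Rightarrow> 'a \<Rightarrow> real) \<Rightarrow> ('a \<Rightarrow> 'a) \<Rightarrow> bool" where
  "p_continuous p T \<longleftrightarrow>
     (\<forall>X x. p_convergent p X x \<longrightarrow> p_convergent p (\<lambda>n. T (X n)) (T x))"

text \<open>Functions from \<open>[0,\<infinity>)\<close> to \<open>[0,\<infinity>)\<close> are total functions on the reals of which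
  only the values on \<open>{0..}\<close> matter.\<close>

definition Phi :: "(real \<Rightarrow> real) set" where
  "Phi = {\<phi>. \<phi> \<in> {0..} \<rightarrow> {0..} \<and> continuous_on {0..} \<phi> \<and> (\<forall>t>0. \<phi> t < t)}"

text \<open>The sequence \<open>\<phi>s\<close> is indexed from 1; the term \<open>\<phi>s 0\<close> is unconstrained.\<close>

definition E_asymptotic_contraction ::
  "('a \<Rightarrow> 'a \<Rightarrow> real) \<Rightarrow> ('a \<Rightarrow> 'a) \<Rightarrow> (nat \<Rightarrow> real \<Rightarrow> real) \<Rightarrow> (real \<Rightarrow> real) \<Rightarrow> bool" where
  "E_asymptotic_contraction p T \<phi>s \<phi> \<longleftrightarrow>
     (\<forall>n\<ge>1. \<phi>s n \<in> {0..} \<rightarrow> {0..}) \<and> \<phi> \<in> Phi \<and>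
     uniform_limit {p x y | x y. True} \<phi>s \<phi> sequentially \<and>
     (\<forall>x y. \<forall>n\<ge>1. p ((T ^^ n) x) ((T ^^ n) y) \<le> \<phi>s n (p x y))"

end

theory Submission imports Defs begin

text \<open>
  As \<open>\<phi>s\<close> converges to \<open>\<phi>\<close> uniformly on the range of \<open>p\<close>, all high iterates of \<open>T\<close> contract
  distances by \<open>\<phi>\<close> itself, up to any error \<open>e > 0\<close> and uniformly in both points. This
  property (\<open>asymptotically_bounded_by\<close>) drives the proof, which has three ideas.

  First, any two orbits merge: the distances \<open>d n = p (T\<^sup>n x) (T\<^sup>n y)\<close> satisfy
  \<open>d (m + n) \<le> \<phi> (d m) + e\<close> for large \<open>n\<close>. This makes them converge to their infimum \<open>a\<close>, and in
  the limit \<open>a \<le> \<phi> a\<close>, which forces \<open>a = 0\<close> (\<open>subinvariant_sequence_tends_to_0\<close>).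

  Second, every orbit is \<open>p\<close>-Cauchy, by an argument in the style of Meir and Keeler. By
  compactness \<open>\<phi>\<close> maps \<open>[0,\<epsilon>]\<close> into \<open>[0,\<epsilon>-\<eta>]\<close> for some \<open>\<eta> > 0\<close>. Hence some \<open>T\<^sup>N\<close> maps points
  at distance at most \<open>\<epsilon>\<close> to points at distance at most \<open>\<epsilon>-\<eta>/2\<close>. Far along the orbit, \<open>N\<close> steps
  cost at most \<open>\<eta>/2\<close> by the first idea, so the triangle inequality keeps the whole tail within
  \<open>\<epsilon>\<close> of its starting point (\<open>orbit_tail_trapped\<close>). As \<open>p\<close> need not be symmetric, the argument
  is applied both to \<open>p\<close> and to \<open>p\<close> with its arguments exchanged.

  Third, a sequence in a separated space has at most one \<open>p\<close>-limit. The \<open>p\<close>-limit \<open>u\<close> of an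
  orbit is therefore fixed, as \<open>T u\<close> is a \<open>p\<close>-limit of the same orbit. Since all orbits merge
  with the constant orbit of a fixed point, every orbit \<open>p\<close>-converges to every fixed point,
  which gives both the uniqueness of \<open>u\<close> and the convergence of all orbits to it.
\<close>

lemma Phi_0:
  assumes "\<phi> \<in> Phi"
  shows "\<phi> 0 = 0"
proof -
  have cont: "continuous_on {0..} \<phi>" and lt: "\<And>t. t > 0 \<Longrightarrow> \<phi> t < t" and "\<phi> 0 \<ge> 0"
    using assms by (auto simp: Phi_def)
  have lim: "(\<lambda>n. inverse (real (Suc n))) \<longlonglongrightarrow> 0"
    by (rule LIMSEQ_inverse_real_of_nat)
  have "(\<lambda>n. \<phi> (inverse (real (Suc n)))) \<longlonglongrightarrow> \<phi> 0"
    by (rule continuous_on_tendsto_compose[OF cont lim]) auto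
  then have "\<phi> 0 \<le> 0"
    by (rule LIMSEQ_le[OF _ lim]) (intro exI allI impI less_imp_le lt, simp)
  with \<open>\<phi> 0 \<ge> 0\<close> show ?thesis by simp
qed

lemma Phi_le:
  assumes "\<phi> \<in> Phi" "t \<ge> 0"
  shows "\<phi> t \<le> t"
  using assms Phi_0[OF assms(1)] by (cases "t = 0") (auto simp: Phi_def less_imp_le)

text \<open>
  The continuous function \<open>\<phi>\<close> attains its maximum on \<open>[0,\<epsilon>]\<close>, and that maximum lies strictly
  below \<open>\<epsilon>\<close>.
\<close>

lemma Phi_gap:
  assumes "\<phi> \<in> Phi" "\<epsilon> > 0"
  obtains \<eta> where "\<eta> > 0" "\<And>t. 0 \<le> t \<Longrightarrow> t \<le> \<epsilon> \<Longrightarrow> \<phi> t + \<eta> \<le> \<epsilon>"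
proof -
  have "continuous_on {0..\<epsilon>} \<phi>"
    using assms by (auto simp: Phi_def intro: continuous_on_subset)
  then obtain s where s: "s \<in> {0..\<epsilon>}" "\<forall>t\<in>{0..\<epsilon>}. \<phi> t \<le> \<phi> s"
    using continuous_attains_sup[of "{0..\<epsilon>}" \<phi>] assms by auto
  have "\<phi> s < s" if "s \<noteq> 0"
    using that s(1) assms(1) by (simp add: Phi_def)
  then have "\<phi> s < \<epsilon>"
    using s(1) assms(2) Phi_0[OF assms(1)] by (cases "s = 0") auto
  show thesis
    by (rule that[of "\<epsilon> - \<phi> s"]) (use s \<open>\<phi> s < \<epsilon>\<close> in auto)
qed

text \<open>
  For a sequence \<open>d\<close> of distances between corresponding points of two orbits, the hypothesis says
  that \<open>limsup d \<le> \<phi> (d m)\<close> for every \<open>m\<close>. As \<open>\<phi> (d m) \<le> d m\<close>, the limit superior is at most the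
  infimum, so the sequence converges; its limit \<open>a\<close> satisfies \<open>a \<le> \<phi> a\<close> by continuity.
\<close>

lemma subinvariant_sequence_tends_to_0:
  fixes d :: "nat \<Rightarrow> real"
  assumes \<phi>: "\<phi> \<in> Phi" and nonneg: "\<And>n. d n \<ge> 0"
    and sub: "\<And>m e. e > 0 \<Longrightarrow> \<forall>\<^sub>F n in sequentially. d n \<le> \<phi> (d m) + e"
  shows "d \<longlonglongrightarrow> 0"
proof -
  define a where "a = Inf (range d)"
  have bdd: "bdd_below (range d)"
    using nonneg by (auto intro: bdd_belowI[of _ 0])
  have a_le: "a \<le> d n" for n
    unfolding a_def using bdd by (simp add: cInf_lower)
  have a_nonneg: "a \<ge> 0"
    unfolding a_def using nonneg by (auto intro!: cINF_greatest)
  have lim: "d \<longlonglongrightarrow> a"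
  proof (rule tendstoI)
    fix e :: real assume "e > 0"
    then obtain m where m: "d m < a + e / 2"
      using cInf_lessD[of "range d" "a + e / 2"] by (auto simp: a_def)
    show "\<forall>\<^sub>F n in sequentially. dist (d n) a < e"
      using sub[of "e / 2" m]
    proof (rule eventually_mono)
      fix n assume "d n \<le> \<phi> (d m) + e / 2"
      then show "dist (d n) a < e"
        using m a_le[of n] Phi_le[OF \<phi> nonneg[of m]] by (simp add: dist_real_def)
    qed (use \<open>e > 0\<close> in simp)
  qed
  have a_le_\<phi>: "a \<le> \<phi> (d m)" for m
  proof (rule field_le_epsilon)
    fix e :: real assume "e > 0"
    from sub[OF this] show "a \<le> \<phi> (d m) + e"
      by (rule tendsto_upperbound[OF lim]) simp
  qed
  have "(\<lambda>m. \<phi> (d m)) \<longlonglongrightarrow> \<phi> a"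
    by (rule continuous_on_tendsto_compose[OF _ lim, of "{0..}"])
       (use \<phi> nonneg a_nonneg in \<open>auto simp: Phi_def\<close>)
  then have "a \<le> \<phi> a"
    by (rule tendsto_lowerbound) (use a_le_\<phi> in auto)
  then have "\<not> a > 0"
    using \<phi> by (auto simp: Phi_def not_less)
  then have "a = 0"
    using a_nonneg by simp
  with lim show ?thesis by simp
qed

text \<open>
  What the contraction condition says once the functions \<open>\<phi>s n\<close> are absorbed into an error term.
  The error is uniform in the two points; this allows one \<open>n\<close> to serve at all positions along an
  orbit.
\<close>

definition asymptotically_bounded_by ::
  "('a \<Rightarrow> 'a \<Rightarrow> real) \<Rightarrow> ('a \<Rightarrow> 'a) \<Rightarrow> (real \<Rightarrow> real) \<Rightarrow> bool" where
  "asymptotically_bounded_by p T \<phi> \<longleftrightarrow>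
     (\<forall>e>0. \<forall>\<^sub>F n in sequentially. \<forall>x y. p ((T ^^ n) x) ((T ^^ n) y) \<le> \<phi> (p x y) + e)"

lemma asymptotically_bounded_byD:
  assumes "asymptotically_bounded_by p T \<phi>" "e > 0"
  shows "\<forall>\<^sub>F n in sequentially. \<forall>x y. p ((T ^^ n) x) ((T ^^ n) y) \<le> \<phi> (p x y) + e"
  using assms unfolding asymptotically_bounded_by_def by blast

lemma asymptotically_bounded_by_flip:
  assumes "asymptotically_bounded_by p T \<phi>"
  shows "asymptotically_bounded_by (\<lambda>x y. p y x) T \<phi>"
  unfolding asymptotically_bounded_by_def
  by (intro allI impI, drule asymptotically_bounded_byD[OF assms]) (auto elim!: eventually_mono)

lemma E_asymptotic_contraction_bounded:
  assumes "E_asymptotic_contraction p T \<phi>s \<phi>"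
  shows "asymptotically_bounded_by p T \<phi>"
  unfolding asymptotically_bounded_by_def
proof (intro allI impI)
  fix e :: real assume "e > 0"
  have "uniform_limit {p x y | x y. True} \<phi>s \<phi> sequentially"
    and contr: "\<And>x y n. n \<ge> 1 \<Longrightarrow> p ((T ^^ n) x) ((T ^^ n) y) \<le> \<phi>s n (p x y)"
    using assms by (auto simp: E_asymptotic_contraction_def)
  then have "\<forall>\<^sub>F n in sequentially. \<forall>t\<in>{p x y | x y. True}. dist (\<phi>s n t) (\<phi> t) < e"
    using \<open>e > 0\<close> by (blast dest: uniform_limitD)
  with eventually_ge_at_top[of 1]
  show "\<forall>\<^sub>F n in sequentially. \<forall>x y. p ((T ^^ n) x) ((T ^^ n) y) \<le> \<phi> (p x y) + e"
  proof eventually_elim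
    case (elim n)
    show ?case
    proof (intro allI)
      fix x y
      have "dist (\<phi>s n (p x y)) (\<phi> (p x y)) < e"
        using elim(2) by blast
      then show "p ((T ^^ n) x) ((T ^^ n) y) \<le> \<phi> (p x y) + e"
        using contr[OF elim(1), of x y] by (simp add: dist_real_def)
    qed
  qed
qed

lemma orbits_merge:
  assumes \<phi>: "\<phi> \<in> Phi" and nonneg: "\<And>x y. p x y \<ge> 0"
    and T: "asymptotically_bounded_by p T \<phi>"
  shows "(\<lambda>n. p ((T ^^ n) x) ((T ^^ n) y)) \<longlonglongrightarrow> 0"
proof (rule subinvariant_sequence_tends_to_0[OF \<phi> nonneg])
  fix m and e :: real assume "e > 0"
  obtain N where N: "\<And>n x y. n \<ge> N \<Longrightarrow> p ((T ^^ n) x) ((T ^^ n) y) \<le> \<phi> (p x y) + e"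
    using asymptotically_bounded_byD[OF T \<open>e > 0\<close>] by (auto simp: eventually_sequentially)
  have "p ((T ^^ n) x) ((T ^^ n) y) \<le> \<phi> (p ((T ^^ m) x) ((T ^^ m) y)) + e" if "n \<ge> N + m" for n
  proof -
    have split: "(T ^^ n) z = (T ^^ (n - m)) ((T ^^ m) z)" for z
      using that funpow_add[of "n - m" m T] by simp
    show ?thesis
      unfolding split using that by (intro N) simp
  qed
  then show "\<forall>\<^sub>F n in sequentially.
      p ((T ^^ n) x) ((T ^^ n) y) \<le> \<phi> (p ((T ^^ m) x) ((T ^^ m) y)) + e"
    unfolding eventually_sequentially by blast
qed

text \<open>
  Let \<open>T\<^sup>N\<close> shrink distances up to \<open>\<epsilon>\<close> to at most \<open>\<epsilon>-\<eta>/2\<close>, and start so late that up to \<open>N\<close>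
  steps along the orbit cost at most \<open>\<eta>/2\<close>. If the point \<open>j - N\<close> steps ahead is within \<open>\<epsilon>\<close> of
  the starting point, then so is the point \<open>j\<close> steps ahead: the path to it goes through the point
  \<open>N\<close> steps ahead, and the second leg is the image under \<open>T\<^sup>N\<close> of a distance of at most \<open>\<epsilon>\<close>.
\<close>

lemma orbit_tail_trapped:
  fixes p :: "'a \<Rightarrow> 'a \<Rightarrow> real"
  assumes \<phi>: "\<phi> \<in> Phi" and nonneg: "\<And>x y. p x y \<ge> 0"
    and triangle: "\<And>x y z. p x y \<le> p x z + p z y"
    and T: "asymptotically_bounded_by p T \<phi>" and "\<epsilon> > 0"
  shows "\<exists>K. \<forall>k\<ge>K. \<forall>j. p ((T ^^ k) x) ((T ^^ (k + j)) x) \<le> \<epsilon>"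
proof -
  obtain \<eta> where \<eta>: "\<eta> > 0" "\<And>t. 0 \<le> t \<Longrightarrow> t \<le> \<epsilon> \<Longrightarrow> \<phi> t + \<eta> \<le> \<epsilon>"
    using Phi_gap[OF \<phi> \<open>\<epsilon> > 0\<close>] by blast
  \<comment> \<open>The induction needs \<open>N > 0\<close> to descend from \<open>j\<close> to \<open>j - N\<close>.\<close>
  have "\<forall>\<^sub>F n in sequentially. n \<ge> 1 \<and>
      (\<forall>x y. p ((T ^^ n) x) ((T ^^ n) y) \<le> \<phi> (p x y) + \<eta> / 2)"
    using \<eta>(1) by (intro eventually_conj eventually_ge_at_top asymptotically_bounded_byD[OF T]) simp
  then obtain N where N: "N \<ge> 1" "\<And>x y. p ((T ^^ N) x) ((T ^^ N) y) \<le> \<phi> (p x y) + \<eta> / 2"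
    by (auto simp: eventually_sequentially)
  have "\<forall>\<^sub>F k in sequentially. \<forall>i\<in>{..N}.
      p ((T ^^ k) x) ((T ^^ k) ((T ^^ i) x)) < min \<epsilon> (\<eta> / 2)"
    using \<open>\<epsilon> > 0\<close> \<eta>(1)
    by (intro eventually_ball_finite ballI order_tendstoD(2)[OF orbits_merge[OF \<phi> nonneg T]]) auto
  then obtain K where
    "\<And>k i. k \<ge> K \<Longrightarrow> i \<le> N \<Longrightarrow> p ((T ^^ k) x) ((T ^^ k) ((T ^^ i) x)) < min \<epsilon> (\<eta> / 2)"
    by (auto simp: eventually_sequentially)
  then have K: "p ((T ^^ k) x) ((T ^^ (k + i)) x) < min \<epsilon> (\<eta> / 2)" if "k \<ge> K" "i \<le> N" for k i
    using that by (simp add: funpow_add)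
  have "p ((T ^^ k) x) ((T ^^ (k + j)) x) \<le> \<epsilon>" if "k \<ge> K" for k j
  proof (induction j rule: less_induct)
    case (less j)
    show ?case
    proof (cases "j \<le> N")
      case True
      with K[OF \<open>k \<ge> K\<close>] show ?thesis by fastforce
    next
      case False
      let ?t = "p ((T ^^ k) x) ((T ^^ (k + (j - N))) x)"
      have shift: "(T ^^ (k + N)) x = (T ^^ N) ((T ^^ k) x)"
        "(T ^^ (k + j)) x = (T ^^ N) ((T ^^ (k + (j - N))) x)"
        using False funpow_add[of N k T] funpow_add[of N "k + (j - N)" T]
        by (simp_all add: add.commute)
      have "?t \<le> \<epsilon>"
        using False N(1) by (intro less.IH) simp
      then have "\<phi> ?t + \<eta> \<le> \<epsilon>"
        by (intro \<eta>(2) nonneg)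
      moreover have "p ((T ^^ (k + N)) x) ((T ^^ (k + j)) x) \<le> \<phi> ?t + \<eta> / 2"
        unfolding shift by (rule N(2))
      moreover have "p ((T ^^ k) x) ((T ^^ (k + N)) x) < \<eta> / 2"
        using K[OF \<open>k \<ge> K\<close>, of N] by simp
      ultimately show ?thesis
        using triangle[of "(T ^^ k) x" "(T ^^ (k + j)) x" "(T ^^ (k + N)) x"] by linarith
    qed
  qed
  then show ?thesis by blast
qed

lemma orbit_p_Cauchy:
  fixes p :: "'a \<Rightarrow> 'a \<Rightarrow> real"
  assumes \<phi>: "\<phi> \<in> Phi" and nonneg: "\<And>x y. p x y \<ge> 0"
    and triangle: "\<And>x y z. p x y \<le> p x z + p z y"
    and T: "asymptotically_bounded_by p T \<phi>"
  shows "p_Cauchy p (\<lambda>n. (T ^^ n) x)"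
  unfolding p_Cauchy_def
proof (rule tendstoI)
  fix e :: real assume "e > 0"
  then have "e / 2 > 0" by simp
  obtain K where K: "\<And>k j. k \<ge> K \<Longrightarrow> p ((T ^^ k) x) ((T ^^ (k + j)) x) \<le> e / 2"
    using orbit_tail_trapped[OF \<phi> nonneg triangle T \<open>e / 2 > 0\<close>] by metis
  have triangle': "p y x \<le> p z x + p y z" for x y z
    using triangle[of y x z] by simp
  obtain L where L: "\<And>k j. k \<ge> L \<Longrightarrow> p ((T ^^ (k + j)) x) ((T ^^ k) x) \<le> e / 2"
    using orbit_tail_trapped[of \<phi> "\<lambda>x y. p y x", OF \<phi> nonneg triangle'
        asymptotically_bounded_by_flip[OF T] \<open>e / 2 > 0\<close>] by metis
  have "p ((T ^^ m) x) ((T ^^ n) x) \<le> e / 2" if "m \<ge> max K L" "n \<ge> max K L" for m n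
    using that K[of m "n - m"] L[of n "m - n"] by (cases "m \<le> n") auto
  then have "dist (p ((T ^^ m) x) ((T ^^ n) x)) 0 < e" if "m \<ge> max K L" "n \<ge> max K L" for m n
    using that \<open>e > 0\<close> nonneg[of "(T ^^ m) x" "(T ^^ n) x"] by (fastforce simp: dist_real_def)
  then show "\<forall>\<^sub>F mn in sequentially \<times>\<^sub>F sequentially.
      dist (case mn of (m, n) \<Rightarrow> p ((T ^^ m) x) ((T ^^ n) x)) 0 < e"
    unfolding eventually_prod_sequentially by (auto intro!: exI[of _ "max K L"])
qed

text \<open>
  Two \<open>p\<close>-limits are \<open>p\<close>-close to a common term of the sequence, hence related by every
  entourage.
\<close>

lemma p_limit_unique:
  fixes p :: "'a::uniform_space \<Rightarrow> 'a \<Rightarrow> real"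
  assumes sep: "separated TYPE('a)" and p: "E_distance p"
    and "p_convergent p X x" "p_convergent p X y"
  shows "x = y"
proof -
  have "(x, y) \<in> U" if "entourage U" for U
  proof -
    obtain \<delta> where \<delta>: "\<delta> > 0" "\<And>x y z. p z x \<le> \<delta> \<Longrightarrow> p z y \<le> \<delta> \<Longrightarrow> (x, y) \<in> U"
      using p \<open>entourage U\<close> unfolding E_distance_def by metis
    have "\<forall>\<^sub>F n in sequentially. p (X n) x < \<delta> \<and> p (X n) y < \<delta>"
      using assms(3,4) \<delta>(1) unfolding p_convergent_def
      by (intro eventually_conj order_tendstoD(2))
    then obtain n where "p (X n) x < \<delta>" "p (X n) y < \<delta>"
      by (auto simp: eventually_sequentially)
    then show ?thesis
      by (intro \<delta>(2)[of "X n"]) simp_all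
  qed
  then have "(x, y) \<in> \<Inter> {U. entourage U}" by blast
  with sep show ?thesis by (simp add: separated_def)
qed

theorem theorem1:
  fixes p :: "'a::uniform_space \<Rightarrow> 'a \<Rightarrow> real"
    and T :: "'a \<Rightarrow> 'a"
    and \<phi>s :: "nat \<Rightarrow> real \<Rightarrow> real" and \<phi> :: "real \<Rightarrow> real"
  assumes "separated TYPE('a)"
    and "E_distance p"
    and "p_complete p"
    and "p_continuous p T"
    and "E_asymptotic_contraction p T \<phi>s \<phi>"
    and "\<forall>\<^sub>F n in sequentially. continuous_on {0..} (\<phi>s n)"
  shows "\<exists>u. T u = u \<and> (\<forall>v. T v = v \<longrightarrow> v = u) \<and>
             (\<forall>x. p_convergent p (\<lambda>n. (T ^^ n) x) u)"
proof -
  have nonneg: "\<And>x y. p x y \<ge> 0" and triangle: "\<And>x y z. p x y \<le> p x z + p z y"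
    using assms(2) by (auto simp: E_distance_def)
  have \<phi>: "\<phi> \<in> Phi"
    using assms(5) by (simp add: E_asymptotic_contraction_def)
  have T: "asymptotically_bounded_by p T \<phi>"
    using assms(5) by (rule E_asymptotic_contraction_bounded)
  note unique = p_limit_unique[OF assms(1,2)]
  have to_fixed: "p_convergent p (\<lambda>n. (T ^^ n) x) v" if "T v = v" for x v
  proof -
    have "(T ^^ n) v = v" for n
      using that by (induction n) simp_all
    then show ?thesis
      using orbits_merge[OF \<phi> nonneg T, of x v] by (simp add: p_convergent_def)
  qed
  fix x\<^sub>0
  obtain u where u: "p_convergent p (\<lambda>n. (T ^^ n) x\<^sub>0) u"
    using assms(3) orbit_p_Cauchy[OF \<phi> nonneg triangle T] unfolding p_complete_def by blast
  have "p_convergent p (\<lambda>n. (T ^^ Suc n) x\<^sub>0) u"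
    using u unfolding p_convergent_def by (rule LIMSEQ_Suc)
  moreover have "p_convergent p (\<lambda>n. (T ^^ Suc n) x\<^sub>0) (T u)"
    using assms(4) u by (simp add: p_continuous_def)
  ultimately have "T u = u"
    by (intro unique)
  then show ?thesis
    using unique to_fixed by blast
qed

end
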